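(* Let $M$ be a monoid (i.e., a cancellative commutative semigroup with identity). The following conditions are equivalent. (a) $M$ is underatomic, i.e., every undermonoid of $M$ is atomic. (b) $M$ is hereditarily atomic, i.e., every submonoid of $M$ is atomic.
   Context: "Monoid" means a cancellative and commutative semigroup with identity, written additively. $\mathcal{U}(M)$ is the group of invertible elements of $M$. $\operatorname{gp}(M)$ is the Grothendieck group of $M$ (the group of differences $\{x-y : x,y\in M\}$, in which $M$ embeds). A submonoid $N$ of $M$ is an undermonoid of $M$ if $\operatorname{gp}(N)=\operatorname{gp}(M)$, where $\operatorname{gp}(N)$ is identified with the subgroup of $\operatorname{gp}(M)$ generated by $N$. An element $a\in M\setminus\mathcal{U}(M)$ is an atom of $M$ if whenever $a=b+c$ with $b,c\in M$, either $b\in\mathcal{U}(M)$ or $c\in\mathcal{U}(M)$. An element of $M$ is atomic if it is invertible or can be written as a sum of finitely many atoms of $M$; $M$ is atomic if every element of $M$ is atomic. *)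

theory Defs
  imports "HOL-Algebra.Divisibility" "HOL-Algebra.Generated_Groups"
begin

text \<open>
  A monoid in the sense used here (commutative, cancellative, with identity) is a
  \<^locale>\<open>comm_monoid_cancel\<close>. It is written multiplicatively, as in HOL-Algebra; sums become
  products and the group of invertible elements is \<^const>\<open>Units\<close>. A submonoid \<open>N\<close> of \<open>M\<close> is
  regarded as a monoid in its own right as \<open>M\<lparr>carrier := N\<rparr>\<close>.
\<close>

section \<open>The Grothendieck group\<close>

text \<open>The pair \<open>(x, y)\<close> stands for the formal difference \<open>x - y\<close>. The relation below is the
  right one only because \<open>M\<close> is cancellative.\<close>

definition gp_rel :: "('a, 'b) monoid_scheme \<Rightarrow> (('a \<times> 'a) \<times> ('a \<times> 'a)) set" where
  "gp_rel M = {((x, y), (x', y')).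
     x \<in> carrier M \<and> y \<in> carrier M \<and> x' \<in> carrier M \<and> y' \<in> carrier M \<and>
     x \<otimes>\<^bsub>M\<^esub> y' = x' \<otimes>\<^bsub>M\<^esub> y}"

definition gp :: "('a, 'b) monoid_scheme \<Rightarrow> ('a \<times> 'a) set monoid" where
  "gp M = \<lparr>carrier = (carrier M \<times> carrier M) // gp_rel M,
           mult = (\<lambda>X Y. \<Union>p\<in>X. \<Union>q\<in>Y. gp_rel M `` {(fst p \<otimes>\<^bsub>M\<^esub> fst q, snd p \<otimes>\<^bsub>M\<^esub> snd q)}),
           one = gp_rel M `` {(\<one>\<^bsub>M\<^esub>, \<one>\<^bsub>M\<^esub>)}\<rparr>"

definition gp_emb :: "('a, 'b) monoid_scheme \<Rightarrow> 'a \<Rightarrow> ('a \<times> 'a) set" where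
  "gp_emb M x = gp_rel M `` {(x, \<one>\<^bsub>M\<^esub>)}"

context comm_monoid_cancel
begin

lemma gp_rel_equiv: "equiv (carrier G \<times> carrier G) (gp_rel G)"
proof (rule equivI)
  show "gp_rel G \<subseteq> (carrier G \<times> carrier G) \<times> (carrier G \<times> carrier G)"
    by (auto simp: gp_rel_def)
  show "refl_on (carrier G \<times> carrier G) (gp_rel G)"
    by (auto simp: refl_on_def gp_rel_def)
  show "sym (gp_rel G)"
    by (auto simp: sym_def gp_rel_def)
  show "trans (gp_rel G)"
  proof (rule transI, clarify)
    fix a b c d e f
    assume 1: "((a, b), (c, d)) \<in> gp_rel G" and 2: "((c, d), (e, f)) \<in> gp_rel G"
    have car: "a \<in> carrier G" "b \<in> carrier G" "c \<in> carrier G" "d \<in> carrier G"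
      "e \<in> carrier G" "f \<in> carrier G"
      and ad: "a \<otimes> d = c \<otimes> b" and cf: "c \<otimes> f = e \<otimes> d"
      using 1 2 by (auto simp: gp_rel_def)
    have "d \<otimes> (a \<otimes> f) = (a \<otimes> d) \<otimes> f" using car by (simp add: m_ac)
    also have "\<dots> = b \<otimes> (c \<otimes> f)" using car by (simp add: ad m_ac)
    also have "\<dots> = d \<otimes> (e \<otimes> b)" using car by (simp add: cf m_ac)
    finally have "a \<otimes> f = e \<otimes> b" using car by (auto dest: l_cancel)
    then show "((a, b), (e, f)) \<in> gp_rel G" using car by (simp add: gp_rel_def)
  qed
qed

lemma gp_rel_class_eq_iff:
  assumes "x \<in> carrier G" "y \<in> carrier G" "x' \<in> carrier G" "y' \<in> carrier G"
  shows "gp_rel G `` {(x, y)} = gp_rel G `` {(x', y')} \<longleftrightarrow> x \<otimes> y' = x' \<otimes> y"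
  using eq_equiv_class_iff[OF gp_rel_equiv, of "(x, y)" "(x', y')"] assms
  by (auto simp: gp_rel_def)

lemma gp_carrierE:
  assumes "X \<in> carrier (gp G)"
  obtains x y where "x \<in> carrier G" "y \<in> carrier G" "X = gp_rel G `` {(x, y)}"
  using assms by (auto simp: gp_def quotient_def)

lemma gp_class_in_carrier:
  "x \<in> carrier G \<Longrightarrow> y \<in> carrier G \<Longrightarrow> gp_rel G `` {(x, y)} \<in> carrier (gp G)"
  by (auto simp: gp_def intro: quotientI)

lemma gp_mult_class:
  assumes "x \<in> carrier G" "y \<in> carrier G" "x' \<in> carrier G" "y' \<in> carrier G"
  shows "gp_rel G `` {(x, y)} \<otimes>\<^bsub>gp G\<^esub> gp_rel G `` {(x', y')}
    = gp_rel G `` {(x \<otimes> x', y \<otimes> y')}"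
proof -
  have eq: "gp_rel G `` {(a \<otimes> a', b \<otimes> b')} = gp_rel G `` {(x \<otimes> x', y \<otimes> y')}"
    if "((x, y), (a, b)) \<in> gp_rel G" "((x', y'), (a', b')) \<in> gp_rel G" for a b a' b'
  proof -
    have car: "a \<in> carrier G" "b \<in> carrier G" "a' \<in> carrier G" "b' \<in> carrier G"
      and e: "x \<otimes> b = a \<otimes> y" "x' \<otimes> b' = a' \<otimes> y'"
      using that by (auto simp: gp_rel_def)
    have "(a \<otimes> a') \<otimes> (y \<otimes> y') = (a \<otimes> y) \<otimes> (a' \<otimes> y')"
      using car assms by (simp add: m_ac)
    also have "\<dots> = (x \<otimes> b) \<otimes> (x' \<otimes> b')" by (simp add: e)
    also have "\<dots> = (x \<otimes> x') \<otimes> (b \<otimes> b')" using car assms by (simp add: m_ac)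
    finally show ?thesis using car assms by (simp add: gp_rel_class_eq_iff)
  qed
  have "(x, y) \<in> gp_rel G `` {(x, y)}" "(x', y') \<in> gp_rel G `` {(x', y')}"
    using assms by (auto simp: gp_rel_def)
  moreover have "gp_rel G `` {(fst p \<otimes> fst q, snd p \<otimes> snd q)} = gp_rel G `` {(x \<otimes> x', y \<otimes> y')}"
    if "p \<in> gp_rel G `` {(x, y)}" "q \<in> gp_rel G `` {(x', y')}" for p q
    using that eq[of "fst p" "snd p" "fst q" "snd q"] by simp
  ultimately have "(\<Union>p\<in>gp_rel G `` {(x, y)}. \<Union>q\<in>gp_rel G `` {(x', y')}.
      gp_rel G `` {(fst p \<otimes> fst q, snd p \<otimes> snd q)}) = gp_rel G `` {(x \<otimes> x', y \<otimes> y')}"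
    by (intro equalityI UN_least) blast+
  then show ?thesis by (simp add: gp_def)
qed

lemma gp_one: "\<one>\<^bsub>gp G\<^esub> = gp_rel G `` {(\<one>, \<one>)}"
  by (simp add: gp_def)

lemma gp_comm_group: "comm_group (gp G)"
proof (rule comm_groupI)
  fix X assume "X \<in> carrier (gp G)"
  then obtain x y where *: "x \<in> carrier G" "y \<in> carrier G" "X = gp_rel G `` {(x, y)}"
    by (rule gp_carrierE)
  then have "gp_rel G `` {(y, x)} \<otimes>\<^bsub>gp G\<^esub> X = \<one>\<^bsub>gp G\<^esub>"
    by (simp add: gp_mult_class gp_one gp_rel_class_eq_iff m_comm)
  then show "\<exists>Y\<in>carrier (gp G). Y \<otimes>\<^bsub>gp G\<^esub> X = \<one>\<^bsub>gp G\<^esub>"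
    using * gp_class_in_carrier by blast
next
  show "\<one>\<^bsub>gp G\<^esub> \<in> carrier (gp G)" by (simp add: gp_one gp_class_in_carrier)
next
  fix X Y assume "X \<in> carrier (gp G)" "Y \<in> carrier (gp G)"
  then show "X \<otimes>\<^bsub>gp G\<^esub> Y \<in> carrier (gp G)" "X \<otimes>\<^bsub>gp G\<^esub> Y = Y \<otimes>\<^bsub>gp G\<^esub> X"
    by (elim gp_carrierE; simp add: gp_mult_class gp_class_in_carrier m_comm)+
next
  fix X Y Z assume "X \<in> carrier (gp G)" "Y \<in> carrier (gp G)" "Z \<in> carrier (gp G)"
  then show "X \<otimes>\<^bsub>gp G\<^esub> Y \<otimes>\<^bsub>gp G\<^esub> Z = X \<otimes>\<^bsub>gp G\<^esub> (Y \<otimes>\<^bsub>gp G\<^esub> Z)"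
    by (elim gp_carrierE) (simp add: gp_mult_class m_assoc)
next
  fix X assume "X \<in> carrier (gp G)"
  then show "\<one>\<^bsub>gp G\<^esub> \<otimes>\<^bsub>gp G\<^esub> X = X"
    by (elim gp_carrierE) (simp add: gp_mult_class gp_one)
qed

lemma gp_emb_hom: "gp_emb G \<in> hom G (gp G)"
  by (auto simp: hom_def gp_emb_def gp_mult_class gp_class_in_carrier)

lemma gp_emb_inj: "inj_on (gp_emb G) (carrier G)"
  by (auto simp: inj_on_def gp_emb_def gp_rel_class_eq_iff)

lemma gp_differences:
  "carrier (gp G) = {gp_emb G x \<otimes>\<^bsub>gp G\<^esub> inv\<^bsub>gp G\<^esub> (gp_emb G y) | x y. x \<in> carrier G \<and> y \<in> carrier G}"
proof -
  interpret gp: comm_group "gp G" by (rule gp_comm_group)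
  have diff: "gp_emb G x \<otimes>\<^bsub>gp G\<^esub> inv\<^bsub>gp G\<^esub> (gp_emb G y) = gp_rel G `` {(x, y)}"
    if "x \<in> carrier G" "y \<in> carrier G" for x y
  proof -
    have "gp_rel G `` {(\<one>, y)} \<otimes>\<^bsub>gp G\<^esub> gp_emb G y = \<one>\<^bsub>gp G\<^esub>"
      using that by (simp add: gp_emb_def gp_mult_class gp_one gp_rel_class_eq_iff)
    then have "inv\<^bsub>gp G\<^esub> (gp_emb G y) = gp_rel G `` {(\<one>, y)}"
      using that by (intro gp.inv_equality) (auto simp: gp_emb_def gp_class_in_carrier)
    then show ?thesis using that by (simp add: gp_emb_def gp_mult_class)
  qed
  show ?thesis
  proof (intro Set.set_eqI iffI)
    fix X assume "X \<in> carrier (gp G)"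
    then obtain x y where "x \<in> carrier G" "y \<in> carrier G" "X = gp_rel G `` {(x, y)}"
      by (rule gp_carrierE)
    then show "X \<in> {gp_emb G x \<otimes>\<^bsub>gp G\<^esub> inv\<^bsub>gp G\<^esub> (gp_emb G y) | x y. x \<in> carrier G \<and> y \<in> carrier G}"
      using diff by blast
  next
    fix X
    assume "X \<in> {gp_emb G x \<otimes>\<^bsub>gp G\<^esub> inv\<^bsub>gp G\<^esub> (gp_emb G y) | x y. x \<in> carrier G \<and> y \<in> carrier G}"
    then show "X \<in> carrier (gp G)"
      using diff gp_class_in_carrier by auto
  qed
qed

end

section \<open>Submonoids and atomicity\<close>

text \<open>\<open>gp(N)\<close> is the subgroup of \<open>gp(M)\<close> generated by (the image of) \<open>N\<close>.\<close>

definition undermonoid :: "'a set \<Rightarrow> ('a, 'b) monoid_scheme \<Rightarrow> bool" where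
  "undermonoid N M \<longleftrightarrow>
     submonoid N M \<and> generate (gp M) (gp_emb M ` N) = carrier (gp M)"

definition atom :: "('a, 'b) monoid_scheme \<Rightarrow> 'a \<Rightarrow> bool" where
  "atom M a \<longleftrightarrow> a \<in> carrier M - Units M \<and>
     (\<forall>b\<in>carrier M. \<forall>c\<in>carrier M. a = b \<otimes>\<^bsub>M\<^esub> c \<longrightarrow> b \<in> Units M \<or> c \<in> Units M)"

definition atomic_element :: "('a, 'b) monoid_scheme \<Rightarrow> 'a \<Rightarrow> bool" where
  "atomic_element M x \<longleftrightarrow> x \<in> Units M \<or>
     (\<exists>as. (\<forall>a\<in>set as. atom M a) \<and> x = foldr (\<otimes>\<^bsub>M\<^esub>) as \<one>\<^bsub>M\<^esub>)"

definition atomic_monoid :: "('a, 'b) monoid_scheme \<Rightarrow> bool" where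
  "atomic_monoid M \<longleftrightarrow> (\<forall>x\<in>carrier M. atomic_element M x)"

definition underatomic :: "('a, 'b) monoid_scheme \<Rightarrow> bool" where
  "underatomic M \<longleftrightarrow> (\<forall>N. undermonoid N M \<longrightarrow> atomic_monoid (M\<lparr>carrier := N\<rparr>))"

definition hereditarily_atomic :: "('a, 'b) monoid_scheme \<Rightarrow> bool" where
  "hereditarily_atomic M \<longleftrightarrow> (\<forall>N. submonoid N M \<longrightarrow> atomic_monoid (M\<lparr>carrier := N\<rparr>))"

end

theory Submission
  imports Defs
begin

text \<open>
  Only the passage from undermonoids to submonoids has content. Let \<open>S\<close> be a submonoid of \<open>M\<close> with
  an element \<open>x\<close> that is not atomic in \<open>S\<close>. Then \<open>S\<close> has to be enlarged to a submonoid \<open>N\<close> that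
  generates \<open>gp(M)\<close>, without making \<open>x\<close> atomic. Whether \<open>x\<close> is atomic depends only on its divisors,
  so it suffices that \<open>x\<close> acquires no new divisor (lemma \<open>atomic_element_if_divisors_in\<close>).

  If \<open>x\<close> is not invertible in \<open>M\<close>, adjoin the ideal \<open>x\<^sup>2M\<close> to \<open>S\<close>: a divisor of \<open>x\<close> in \<open>x\<^sup>2M\<close> would make
  \<open>x\<close> invertible, and \<open>x\<close> together with \<open>x\<^sup>2M\<close> generates \<open>gp(M)\<close>. In general replace \<open>M\<close> here by a
  submonoid \<open>P\<close> that contains \<open>S\<close> and is maximal subject to containing no inverse of \<open>x\<close>. Such a \<open>P\<close>
  exists by Zorn's lemma, and \<open>S \<union> x\<^sup>2P\<close> keeps the divisors of \<open>x\<close> as before. It still generates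
  \<open>gp(M)\<close>, because \<open>P\<close> behaves like a valuation monoid: every element of \<open>M\<close> outside \<open>P\<close> is
  invertible and its inverse is in \<open>P\<close> (lemma \<open>inverse_in_maximal_avoiding\<close>).
\<close>

context comm_monoid_cancel
begin

section \<open>Atomicity depends only on divisors\<close>

lemma Units_submonoid_iff:
  assumes "submonoid N G"
  shows "a \<in> Units (G\<lparr>carrier := N\<rparr>) \<longleftrightarrow> a \<in> N \<and> (\<exists>b\<in>N. a \<otimes> b = \<one>)"
  using submonoid.subset[OF assms] by (force simp: Units_def m_comm subset_iff)

lemma foldr_mult_in_submonoid:
  assumes "submonoid N G" "set as \<subseteq> N"
  shows "foldr (\<otimes>) as \<one> \<in> N"
  using assms(2)
  by (induction as) (auto intro: submonoid.m_closed[OF assms(1)] submonoid.one_closed[OF assms(1)])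

lemma factor_divides_foldr:
  assumes N: "submonoid N G" and "set as \<subseteq> N" "a \<in> set as"
  shows "\<exists>b\<in>N. a \<otimes> b = foldr (\<otimes>) as \<one>"
  using assms(2,3)
proof (induction as)
  case (Cons c as)
  have car: "N \<subseteq> carrier G" by (rule submonoid.subset[OF N])
  show ?case
  proof (cases "a = c")
    case True
    then show ?thesis using Cons.prems foldr_mult_in_submonoid[OF N, of as] by auto
  next
    case False
    then obtain b where b: "b \<in> N" "a \<otimes> b = foldr (\<otimes>) as \<one>" using Cons by auto
    have "a \<otimes> (c \<otimes> b) = c \<otimes> foldr (\<otimes>) as \<one>"
      using b car Cons.prems by (subst b(2)[symmetric], intro m_lcomm) auto
    then show ?thesis using b(1) Cons.prems submonoid.m_closed[OF N, of c b] by auto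
  qed
qed simp

text \<open>Units, atoms and factorizations that matter for \<open>x\<close> all consist of divisors of \<open>x\<close>; in
  particular units divide everything, so that even the inverse in \<open>N\<close> of a unit of \<open>N\<close> is a divisor of
  \<open>x\<close> and hence in \<open>S\<close>.\<close>

lemma atomic_element_if_divisors_in:
  assumes S: "submonoid S G" and N: "submonoid N G" and "S \<subseteq> N"
    and div: "\<And>a b. a \<in> N \<Longrightarrow> b \<in> N \<Longrightarrow> a \<otimes> b = x \<Longrightarrow> a \<in> S"
    and x: "x \<in> S" and at: "atomic_element (G\<lparr>carrier := N\<rparr>) x"
  shows "atomic_element (G\<lparr>carrier := S\<rparr>) x"
proof -
  have car: "N \<subseteq> carrier G" by (rule submonoid.subset[OF N])
  have xN: "x \<in> N" using x \<open>S \<subseteq> N\<close> by auto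
  have unit: "a \<in> Units (G\<lparr>carrier := S\<rparr>)"
    if a: "a \<in> Units (G\<lparr>carrier := N\<rparr>)" "a \<in> S" for a
  proof -
    obtain b where b: "a \<in> N" "b \<in> N" "a \<otimes> b = \<one>"
      using a(1) by (auto simp: Units_submonoid_iff[OF N])
    have "b \<otimes> (a \<otimes> x) = (a \<otimes> b) \<otimes> x" using b(1,2) xN car by (simp add: m_ac subset_iff)
    also have "\<dots> = x" using b xN car by auto
    finally have "b \<in> S" using div b xN submonoid.m_closed[OF N] by blast
    then show ?thesis using b a(2) by (auto simp: Units_submonoid_iff[OF S])
  qed
  have unit_iff: "a \<in> Units (G\<lparr>carrier := S\<rparr>) \<longleftrightarrow> a \<in> Units (G\<lparr>carrier := N\<rparr>)" if "a \<in> S" for a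
    using unit that \<open>S \<subseteq> N\<close>
    by (auto simp: Units_submonoid_iff[OF S] Units_submonoid_iff[OF N])
  from at consider "x \<in> Units (G\<lparr>carrier := N\<rparr>)"
    | as where "\<forall>a\<in>set as. atom (G\<lparr>carrier := N\<rparr>) a" "x = foldr (\<otimes>) as \<one>"
    by (auto simp: atomic_element_def)
  then show ?thesis
  proof cases
    case 1
    then show ?thesis using unit x by (simp add: atomic_element_def)
  next
    case 2
    have sub: "set as \<subseteq> N" using 2(1) by (auto simp: atom_def)
    have "atom (G\<lparr>carrier := S\<rparr>) a" if a: "a \<in> set as" for a
    proof -
      have "a \<in> S" using factor_divides_foldr[OF N sub a] div sub a 2(2) by blast
      then show ?thesis using 2(1) a unit_iff \<open>S \<subseteq> N\<close>
        by (auto simp: atom_def subset_iff)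
    qed
    then show ?thesis using 2(2) by (auto simp: atomic_element_def)
  qed
qed

section \<open>Maximal submonoids without an inverse of a given element\<close>

definition avoids_inverse :: "'a \<Rightarrow> 'a set \<Rightarrow> bool" where
  "avoids_inverse x P \<longleftrightarrow> (\<forall>p\<in>P. x \<otimes> p \<noteq> \<one>)"

definition adjoin :: "'a set \<Rightarrow> 'a \<Rightarrow> 'a set" where
  "adjoin P m = {p \<otimes> m [^] k | p (k::nat). p \<in> P}"

lemma submonoid_adjoin:
  assumes P: "submonoid P G" and m: "m \<in> carrier G"
  shows "submonoid (adjoin P m) G" "P \<subseteq> adjoin P m" "m \<in> adjoin P m"
proof -
  have car: "P \<subseteq> carrier G" by (rule submonoid.subset[OF P])
  show sub: "P \<subseteq> adjoin P m"
  proof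
    fix p assume "p \<in> P"
    moreover have "p = p \<otimes> m [^] (0::nat)" using \<open>p \<in> P\<close> car by auto
    ultimately show "p \<in> adjoin P m" unfolding adjoin_def by blast
  qed
  have "m = \<one> \<otimes> m [^] (1::nat)" using m by simp
  then show "m \<in> adjoin P m"
    unfolding adjoin_def using submonoid.one_closed[OF P] by blast
  show "submonoid (adjoin P m) G"
  proof
    show "adjoin P m \<subseteq> carrier G" using car m by (auto simp: adjoin_def)
    show "\<one> \<in> adjoin P m" using sub submonoid.one_closed[OF P] by auto
    fix a b assume "a \<in> adjoin P m" "b \<in> adjoin P m"
    then obtain p q and k l :: nat
      where *: "p \<in> P" "q \<in> P" "a = p \<otimes> m [^] k" "b = q \<otimes> m [^] l"
      by (auto simp: adjoin_def)
    have "a \<otimes> b = (p \<otimes> q) \<otimes> m [^] (k + l)"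
      using * car m by (simp add: nat_pow_mult[symmetric] m_ac subset_iff)
    then show "a \<otimes> b \<in> adjoin P m"
      unfolding adjoin_def using * submonoid.m_closed[OF P] by blast
  qed
qed

lemma nat_pow_in_submonoid: "submonoid P G \<Longrightarrow> p \<in> P \<Longrightarrow> p [^] (n::nat) \<in> P"
  by (induction n) (auto simp: submonoid.one_closed submonoid.m_closed)

lemma exists_maximal_avoiding:
  assumes S: "submonoid S G" and av: "avoids_inverse x S"
  obtains P where "submonoid P G" "S \<subseteq> P" "avoids_inverse x P"
    "\<And>Q. submonoid Q G \<Longrightarrow> P \<subseteq> Q \<Longrightarrow> avoids_inverse x Q \<Longrightarrow> Q = P"
proof -
  let ?A = "{P. submonoid P G \<and> S \<subseteq> P \<and> avoids_inverse x P}"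
  have "\<exists>P\<in>?A. \<forall>Q\<in>?A. P \<subseteq> Q \<longrightarrow> Q = P"
  proof (rule subset_Zorn_nonempty)
    show "?A \<noteq> {}" using S av by auto
    fix C assume ne: "C \<noteq> {}" and ch: "subset.chain ?A C"
    have C: "submonoid P G" "S \<subseteq> P" "avoids_inverse x P" if "P \<in> C" for P
      using ch that by (auto simp: subset.chain_def)
    have "submonoid (\<Union>C) G"
    proof
      show "\<Union>C \<subseteq> carrier G" using C(1) submonoid.subset by blast
      show "\<one> \<in> \<Union>C" using ne submonoid.one_closed[OF C(1)] by auto
      fix a b assume "a \<in> \<Union>C" "b \<in> \<Union>C"
      then obtain P Q where PQ: "P \<in> C" "Q \<in> C" "a \<in> P" "b \<in> Q" by auto
      then have "P \<subseteq> Q \<or> Q \<subseteq> P" using ch by (auto simp: subset_chain_def)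
      then obtain R where R: "R \<in> C" "a \<in> R" "b \<in> R" using PQ by blast
      then show "a \<otimes> b \<in> \<Union>C" using submonoid.m_closed[OF C(1)[OF R(1)]] by auto
    qed
    moreover have "S \<subseteq> \<Union>C" using ne C(2) by blast
    moreover have "avoids_inverse x (\<Union>C)" using C(3) by (auto simp: avoids_inverse_def)
    ultimately show "\<Union>C \<in> ?A" by simp
  qed
  then obtain P where "P \<in> ?A" and max: "\<And>Q. Q \<in> ?A \<Longrightarrow> P \<subseteq> Q \<Longrightarrow> Q = P"
    by auto
  then show thesis by (intro that[of P]) auto
qed

text \<open>By maximality, adjoining \<open>m \<notin> P\<close> to \<open>P\<close> creates an inverse of \<open>x\<close>, say \<open>x p m\<^sup>k = 1\<close>; here
  \<open>k \<ge> 1\<close>, as \<open>P\<close> itself contains no inverse of \<open>x\<close>, so \<open>m\<close> has an inverse \<open>m'\<close>.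
  If \<open>m'\<close> were not in \<open>P\<close> either, then also \<open>x q m'\<^sup>l = 1\<close>. In the product of the
  \<open>l\<close>-th power of the first equation and the \<open>k\<close>-th power of the second, \<open>m\<close> and \<open>m'\<close> cancel, and
  \<open>x\<^sup>k\<^sup>+\<^sup>l p\<^sup>l q\<^sup>k = 1\<close> exhibits an inverse of \<open>x\<close> in \<open>P\<close>.\<close>

lemma inverse_in_maximal_avoiding:
  assumes P: "submonoid P G" and x: "x \<in> P" and av: "avoids_inverse x P"
    and max: "\<And>Q. submonoid Q G \<Longrightarrow> P \<subseteq> Q \<Longrightarrow> avoids_inverse x Q \<Longrightarrow> Q = P"
    and m: "m \<in> carrier G" "m \<notin> P"
  shows "\<exists>m'\<in>P. m \<otimes> m' = \<one>"
proof -
  have car: "P \<subseteq> carrier G" by (rule submonoid.subset[OF P])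
  have xc: "x \<in> carrier G" using x car by auto
  have ext: "\<exists>p\<in>P. \<exists>k. x \<otimes> (p \<otimes> g [^] Suc k) = \<one>" if g: "g \<in> carrier G" "g \<notin> P" for g
  proof -
    have "\<not> avoids_inverse x (adjoin P g)" using max submonoid_adjoin[OF P g(1)] g(2) by blast
    then obtain p and k :: nat where pk: "p \<in> P" "x \<otimes> (p \<otimes> g [^] k) = \<one>"
      by (auto simp: avoids_inverse_def adjoin_def)
    have "k \<noteq> 0" using pk av car by (intro notI) (auto simp: avoids_inverse_def)
    then show ?thesis using pk by (metis not0_implies_Suc)
  qed
  obtain p k where p: "p \<in> P" and pk: "x \<otimes> (p \<otimes> m [^] Suc k) = \<one>" using ext[OF m] by auto
  have pc: "p \<in> carrier G" using p car by auto
  define m' where "m' = x \<otimes> (p \<otimes> m [^] k)"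
  have m'c: "m' \<in> carrier G" using xc pc m by (simp add: m'_def)
  have mm': "m \<otimes> m' = \<one>" using pk xc pc m by (simp add: m'_def m_ac)
  have "m' \<in> P"
  proof (rule ccontr)
    assume "m' \<notin> P"
    then obtain q l where q: "q \<in> P" and ql: "x \<otimes> (q \<otimes> m' [^] Suc l) = \<one>"
      using ext[OF m'c] by auto
    have qc: "q \<in> carrier G" using q car by auto
    let ?K = "Suc k" and ?L = "Suc l"
    let ?r = "x [^] (k + ?L) \<otimes> (p [^] ?L \<otimes> q [^] ?K)"
    have cancel: "m [^] (?K * ?L) \<otimes> m' [^] (?K * ?L) = \<one>"
      using nat_pow_distrib[OF m(1) m'c, of "?K * ?L"] unfolding mm' nat_pow_one by (rule sym)
    have "\<one> = (x \<otimes> (p \<otimes> m [^] ?K)) [^] ?L \<otimes> (x \<otimes> (q \<otimes> m' [^] ?L)) [^] ?K"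
      unfolding pk ql nat_pow_one by simp
    also have "\<dots> = (x [^] ?L \<otimes> (p [^] ?L \<otimes> m [^] (?K * ?L)))
        \<otimes> (x [^] ?K \<otimes> (q [^] ?K \<otimes> m' [^] (?K * ?L)))"
      using xc pc qc m(1) m'c
      by (simp only: nat_pow_distrib m_closed nat_pow_closed nat_pow_pow mult.commute)
    also have "\<dots> = (x [^] ?L \<otimes> x [^] ?K) \<otimes> (p [^] ?L \<otimes> q [^] ?K)
        \<otimes> (m [^] (?K * ?L) \<otimes> m' [^] (?K * ?L))"
      using xc pc qc m(1) m'c by (simp only: m_ac m_closed nat_pow_closed)
    also have "\<dots> = x [^] Suc (k + ?L) \<otimes> (p [^] ?L \<otimes> q [^] ?K)"
      using nat_pow_mult[OF xc, of ?L ?K] xc pc qc unfolding cancel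
      by (simp only: r_one m_closed nat_pow_closed add_Suc add.commute)
    also have "\<dots> = x \<otimes> ?r"
      using xc pc qc by (simp only: nat_pow_Suc m_ac m_closed nat_pow_closed)
    finally have "x \<otimes> ?r = \<one>" by simp
    moreover have "?r \<in> P"
      using P x p q by (intro submonoid.m_closed[OF P] nat_pow_in_submonoid)
    ultimately show False using av unfolding avoids_inverse_def by blast
  qed
  then show ?thesis using mm' by auto
qed

section \<open>An undermonoid without new divisors\<close>

lemma undermonoidI:
  assumes N: "submonoid N G"
    and gen: "\<And>m. m \<in> carrier G \<Longrightarrow> gp_emb G m \<in> generate (gp G) (gp_emb G ` N)"
  shows "undermonoid N G"
proof -
  interpret gp: comm_group "gp G" by (rule gp_comm_group)
  have sub: "gp_emb G ` N \<subseteq> carrier (gp G)"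
    using submonoid.subset[OF N] gp_emb_hom by (auto simp: hom_def)
  have H: "subgroup (generate (gp G) (gp_emb G ` N)) (gp G)"
    by (rule gp.generate_is_subgroup[OF sub])
  have "carrier (gp G) \<subseteq> generate (gp G) (gp_emb G ` N)"
    unfolding gp_differences using gen H
    by (auto intro!: subgroup.m_closed[OF H] subgroup.m_inv_closed[OF H])
  then show ?thesis using N subgroup.subset[OF H] by (auto simp: undermonoid_def)
qed

text \<open>A divisor of \<open>x\<close> in \<open>x\<^sup>2P\<close> would be a witness that \<open>x\<close> is invertible in \<open>P\<close>. The ideal \<open>x P\<close> would
  not do: if \<open>u \<in> S\<close> has an inverse \<open>u'\<close> in \<open>P\<close> but not in \<open>S\<close>, then \<open>x u'\<close> may be a new divisor of
  \<open>x\<close>.\<close>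

lemma exists_undermonoid_same_divisors:
  assumes S: "submonoid S G" and x: "x \<in> S" and av: "avoids_inverse x S"
  obtains N where "undermonoid N G" "S \<subseteq> N"
    "\<And>a b. a \<in> N \<Longrightarrow> b \<in> N \<Longrightarrow> a \<otimes> b = x \<Longrightarrow> a \<in> S"
proof -
  obtain P where P: "submonoid P G" and SP: "S \<subseteq> P" and avP: "avoids_inverse x P"
    and max: "\<And>Q. submonoid Q G \<Longrightarrow> P \<subseteq> Q \<Longrightarrow> avoids_inverse x Q \<Longrightarrow> Q = P"
    using exists_maximal_avoiding[OF S av] by blast
  have car: "P \<subseteq> carrier G" by (rule submonoid.subset[OF P])
  have xP: "x \<in> P" using x SP by auto
  have xc: "x \<in> carrier G" using xP car by auto
  define I where "I = (\<lambda>p. x \<otimes> (x \<otimes> p)) ` P"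
  have IP: "I \<subseteq> P" using submonoid.m_closed[OF P] xP by (auto simp: I_def)
  have ideal: "a \<otimes> b \<in> I" "b \<otimes> a \<in> I" if ab: "a \<in> I" "b \<in> P" for a b
  proof -
    obtain p where p: "p \<in> P" "a = x \<otimes> (x \<otimes> p)" using ab by (auto simp: I_def)
    have "a \<otimes> b = x \<otimes> (x \<otimes> (p \<otimes> b))" using p ab(2) xc car by (simp add: m_ac subset_iff)
    then show "a \<otimes> b \<in> I" using submonoid.m_closed[OF P p(1) ab(2)] by (auto simp: I_def)
    then show "b \<otimes> a \<in> I" using IP car ab by (metis m_comm subsetD)
  qed
  have N: "submonoid (S \<union> I) G"
  proof
    show "S \<union> I \<subseteq> carrier G" using SP IP car by auto
    show "\<one> \<in> S \<union> I" using submonoid.one_closed[OF S] by simp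
    show "a \<otimes> b \<in> S \<union> I" if "a \<in> S \<union> I" "b \<in> S \<union> I" for a b
      using that ideal submonoid.m_closed[OF S] SP IP by blast
  qed
  interpret gp: comm_group "gp G" by (rule gp_comm_group)
  let ?H = "generate (gp G) (gp_emb G ` (S \<union> I))"
  have H: "subgroup ?H (gp G)"
    using submonoid.subset[OF N] gp_emb_hom
    by (intro gp.generate_is_subgroup) (auto simp: hom_def)
  have emb_c: "gp_emb G a \<in> carrier (gp G)" if "a \<in> carrier G" for a
    using that gp_emb_hom by (auto simp: hom_def)
  have emb_mult: "gp_emb G (a \<otimes> b) = gp_emb G a \<otimes>\<^bsub>gp G\<^esub> gp_emb G b"
    if "a \<in> carrier G" "b \<in> carrier G" for a b
    using that gp_emb_hom by (auto simp: hom_def)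
  have H_cancel: "gp_emb G b \<in> ?H"
    if "a \<in> carrier G" "b \<in> carrier G" "gp_emb G a \<in> ?H" "gp_emb G (a \<otimes> b) \<in> ?H" for a b
  proof -
    have "gp_emb G b = inv\<^bsub>gp G\<^esub> (gp_emb G a) \<otimes>\<^bsub>gp G\<^esub> gp_emb G (a \<otimes> b)"
      using that by (simp add: emb_mult emb_c gp.m_assoc[symmetric])
    then show ?thesis
      using that(3,4) by (simp add: subgroup.m_closed[OF H] subgroup.m_inv_closed[OF H])
  qed
  have HN: "gp_emb G a \<in> ?H" if "a \<in> S \<union> I" for a
    using that by (intro generate.incl) auto
  have HP: "gp_emb G p \<in> ?H" if p: "p \<in> P" for p
  proof -
    have pc: "p \<in> carrier G" using p car by auto
    have "gp_emb G (x \<otimes> (x \<otimes> p)) \<in> ?H" using p by (intro HN) (auto simp: I_def)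
    then show ?thesis using HN[of x] x xc pc by (auto intro: H_cancel)
  qed
  have "gp_emb G m \<in> ?H" if m: "m \<in> carrier G" for m
  proof (cases "m \<in> P")
    case False
    then obtain m' where m': "m' \<in> P" "m \<otimes> m' = \<one>"
      using inverse_in_maximal_avoiding[OF P xP avP max m] by blast
    have m'c: "m' \<in> carrier G" using m' car by auto
    have "gp_emb G (m' \<otimes> m) \<in> ?H"
      using m' m m'c HP submonoid.one_closed[OF P] by (simp add: m_comm)
    then show ?thesis using H_cancel[of m' m] HP m' m m'c by auto
  qed (rule HP)
  then have "undermonoid (S \<union> I) G" by (rule undermonoidI[OF N])
  moreover have "a \<in> S" if ab: "a \<in> S \<union> I" "b \<in> S \<union> I" "a \<otimes> b = x" for a b
  proof (rule ccontr)
    assume "a \<notin> S"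
    then obtain p where p: "p \<in> P" "a = x \<otimes> (x \<otimes> p)" using ab by (auto simp: I_def)
    have b: "b \<in> P" using ab(2) SP IP by auto
    have "x \<otimes> (x \<otimes> (p \<otimes> b)) = x \<otimes> \<one>"
      using ab(3) p b xc car by (simp add: m_assoc subset_iff)
    then have "x \<otimes> (p \<otimes> b) = \<one>"
      using l_cancel xc p(1) b car by (meson m_closed one_closed subsetD)
    then show False
      using avP submonoid.m_closed[OF P p(1) b] by (auto simp: avoids_inverse_def)
  qed
  ultimately show thesis using that[of "S \<union> I"] by blast
qed

end

section \<open>Underatomic monoids are hereditarily atomic\<close>

theorem theorem3p3:
  fixes M :: "('a, 'b) monoid_scheme"
  assumes "comm_monoid_cancel M"
  shows "underatomic M \<longleftrightarrow> hereditarily_atomic M"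
proof
  interpret comm_monoid_cancel M by (rule assms)
  assume ua: "underatomic M"
  have "atomic_element (M\<lparr>carrier := S\<rparr>) x" if S: "submonoid S M" and x: "x \<in> S" for S x
  proof (cases "avoids_inverse x S")
    case False
    then have "x \<in> Units (M\<lparr>carrier := S\<rparr>)"
      using x by (auto simp: avoids_inverse_def Units_submonoid_iff[OF S])
    then show ?thesis by (simp add: atomic_element_def)
  next
    case True
    then obtain N where N: "undermonoid N M" "S \<subseteq> N"
      and div: "\<And>a b. a \<in> N \<Longrightarrow> b \<in> N \<Longrightarrow> a \<otimes>\<^bsub>M\<^esub> b = x \<Longrightarrow> a \<in> S"
      using exists_undermonoid_same_divisors[OF S x] by blast
    show ?thesis
    proof (rule atomic_element_if_divisors_in[OF S _ N(2) _ x])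
      show "submonoid N M" using N(1) by (simp add: undermonoid_def)
      show "a \<in> S" if "a \<in> N" "b \<in> N" "a \<otimes>\<^bsub>M\<^esub> b = x" for a b
        using that by (rule div)
      show "atomic_element (M\<lparr>carrier := N\<rparr>) x"
        using ua N x by (auto simp: underatomic_def atomic_monoid_def)
    qed
  qed
  then show "hereditarily_atomic M" by (auto simp: hereditarily_atomic_def atomic_monoid_def)
next
  assume "hereditarily_atomic M"
  then show "underatomic M"
    by (auto simp: hereditarily_atomic_def underatomic_def undermonoid_def)
qed

end
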